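(* Every $\mathcal{R}^{(2)}$-module $V$ has a $(\mathcal{R}^{(2)}, \mathcal{R})$-basis.
   Context: Let $\mathcal{R}$ be the field of real numbers. The dual real number algebra is the 2-dimensional commutative associative real algebra $\mathcal{R}^{(2)}=\mathcal{R}\oplus\mathcal{R}\,1^{\#}$ with basis $\{1,1^{\#}\}$ and product $(x_1+x_2 1^{\#})(y_1+y_2 1^{\#})=x_1y_1+(x_1y_2+x_2y_1)1^{\#}$ for $x_1,x_2,y_1,y_2\in\mathcal{R}$ (so $1^{\#}1^{\#}=0$); $\mathcal{R}$ is identified with the subalgebra $\mathcal{R}\cdot 1$. For an $\mathcal{R}^{(2)}$-module $V$, put $Ker\,1^{\#}_V:=\{v\in V \mid 1^{\#}v=0\}$. A $(\mathcal{R}^{(2)},\mathcal{R})$-basis for $V$ is a subset $\beta=(S_1\,\|\,S_2):=S_1\cup S_2$ of $V$ (with the decomposition into $S_1$ and $S_2$ being part of the data) such that: (i) $S_1\subseteq V$ and $S_2\subseteq Ker\,1^{\#}_V$; (ii) $\beta$ is $(\mathcal{R}^{(2)}\,\|\,\mathcal{R})$-linearly independent: for any finite families of distinct elements $v_1,\dots,v_s\in S_1$ and distinct elements $w_1,\dots,w_t\in S_2$, and any $c_1,\dots,c_s\in\mathcal{R}^{(2)}$ and $d_1,\dots,d_t\in\mathcal{R}$, the equality $\sum_{i=1}^s c_iv_i+\sum_{j=1}^t d_jw_j=0$ implies that all $c_i=0$ and all $d_j=0$; (iii) every $v\in V$ can be written as a finite sum $v=\sum_{i=1}^s c_iv_i+\sum_{j=1}^t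 d_jw_j$ with $v_i\in S_1$, $w_j\in S_2$, $c_i\in\mathcal{R}^{(2)}$ and $d_j\in\mathcal{R}$. The sets $S_1,S_2$ may be empty or infinite. *)

theory Defs
  imports Complex_Main
begin

text \<open>The dual real number algebra: \<open>Dual x y\<close> stands for \<open>x + y 1\<^sup>#\<close>. The subalgebra of
  real multiples of \<open>1\<close> is the image of \<^const>\<open>of_real\<close>.\<close>

datatype dual_real = Dual (dfst: real) (dsnd: real)

instantiation dual_real :: "{comm_ring_1, real_algebra_1}"
begin

definition zero_dual_real_def: "0 = Dual 0 0"
definition one_dual_real_def: "1 = Dual 1 0"
definition plus_dual_real_def: "a + b = Dual (dfst a + dfst b) (dsnd a + dsnd b)"
definition minus_dual_real_def: "a - b = Dual (dfst a - dfst b) (dsnd a - dsnd b)"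
definition uminus_dual_real_def: "- a = Dual (- dfst a) (- dsnd a)"
definition times_dual_real_def:
  "a * b = Dual (dfst a * dfst b) (dfst a * dsnd b + dsnd a * dfst b)"
definition scaleR_dual_real_def: "r *\<^sub>R a = Dual (r * dfst a) (r * dsnd a)"

instance
  by standard
    (auto simp: zero_dual_real_def one_dual_real_def plus_dual_real_def minus_dual_real_def
      uminus_dual_real_def times_dual_real_def scaleR_dual_real_def algebra_simps)

end

lemma of_real_dual_real: "of_real r = Dual r 0"
  by (simp add: of_real_def scaleR_dual_real_def one_dual_real_def)

definition one_sharp :: dual_real where
  "one_sharp = Dual 0 1"

lemma Dual_eq: "Dual x y = of_real x + of_real y * one_sharp"
  by (simp add: of_real_dual_real one_sharp_def plus_dual_real_def times_dual_real_def)

lemma one_sharp_mult_self: "one_sharp * one_sharp = 0"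
  by (simp add: one_sharp_def zero_dual_real_def times_dual_real_def)

definition Ker_one_sharp :: "(dual_real \<Rightarrow> 'v::ab_group_add \<Rightarrow> 'v) \<Rightarrow> 'v set" where
  "Ker_one_sharp scale = {v. scale one_sharp v = 0}"

text \<open>A finite family of distinct elements of \<open>S1\<close> is encoded as a finite subset \<open>A\<close> of \<open>S1\<close>,
  with coefficients given by a function of which only the values on \<open>A\<close> matter; likewise for
  \<open>S2\<close>. Repeated elements in the spanning condition can be collected, so nothing is lost there.\<close>

definition dual_independent ::
    "(dual_real \<Rightarrow> 'v::ab_group_add \<Rightarrow> 'v) \<Rightarrow> 'v set \<Rightarrow> 'v set \<Rightarrow> bool" where
  "dual_independent scale S1 S2 \<longleftrightarrow>
    (\<forall>A B (c :: 'v \<Rightarrow> dual_real) (d :: 'v \<Rightarrow> real).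
      finite A \<and> A \<subseteq> S1 \<and> finite B \<and> B \<subseteq> S2 \<and>
      (\<Sum>v\<in>A. scale (c v) v) + (\<Sum>w\<in>B. scale (of_real (d w)) w) = 0
      \<longrightarrow> (\<forall>v\<in>A. c v = 0) \<and> (\<forall>w\<in>B. d w = 0))"

definition dual_spanning ::
    "(dual_real \<Rightarrow> 'v::ab_group_add \<Rightarrow> 'v) \<Rightarrow> 'v set \<Rightarrow> 'v set \<Rightarrow> bool" where
  "dual_spanning scale S1 S2 \<longleftrightarrow>
    (\<forall>x. \<exists>A B (c :: 'v \<Rightarrow> dual_real) (d :: 'v \<Rightarrow> real).
      finite A \<and> A \<subseteq> S1 \<and> finite B \<and> B \<subseteq> S2 \<and>
      x = (\<Sum>v\<in>A. scale (c v) v) + (\<Sum>w\<in>B. scale (of_real (d w)) w))"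

text \<open>Disjointness of \<open>S1\<close> and \<open>S2\<close> is not required: it follows from the other conditions, since
  \<open>1\<^sup># v = 0\<close> for \<open>v\<close> in \<open>S2\<close>, which independence forbids for \<open>v\<close> in \<open>S1\<close>.\<close>

definition dual_basis ::
    "(dual_real \<Rightarrow> 'v::ab_group_add \<Rightarrow> 'v) \<Rightarrow> 'v set \<Rightarrow> 'v set \<Rightarrow> bool" where
  "dual_basis scale S1 S2 \<longleftrightarrow>
    S2 \<subseteq> Ker_one_sharp scale \<and> dual_independent scale S1 S2 \<and> dual_spanning scale S1 S2"

end

theory Submission
  imports Defs
begin

text \<open>
  Multiplication by \<open>1\<^sup>#\<close> is an \<open>\<real>\<close>-linear endomorphism \<open>N\<close> of \<open>V\<close> (below: \<open>sharp\<close>) with \<open>N \<circ> N = 0\<close>, and the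
  \<open>\<real>\<^sup>(\<^sup>2\<^sup>)\<close>-module structure is nothing more than this endomorphism: \<open>(a + b 1\<^sup>#) v = a v + b N v\<close>.
  A basis of the required kind is therefore a Jordan basis of a square-zero operator, with the
  elements of \<open>S1\<close> heading the blocks of size two and \<open>S2\<close> collecting the blocks of size one.

  Since \<open>range N \<subseteq> Ker N\<close>, an \<open>\<real>\<close>-basis \<open>B0\<close> of \<open>range N\<close> extends to an \<open>\<real>\<close>-basis \<open>B\<close> of \<open>Ker N\<close>.
  Let \<open>S1\<close> consist of one \<open>N\<close>-preimage for each element of \<open>B0\<close>, and let \<open>S2 = B - B0\<close>.
  Thus \<open>N\<close> is injective on \<open>S1\<close>, and \<open>N ` S1\<close> and \<open>S2\<close> partition a basis of \<open>Ker N\<close>. Given a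
  relation among \<open>S1\<close> and \<open>S2\<close>, applying \<open>N\<close> kills everything except the real parts of the
  \<open>S1\<close>-coefficients, which must therefore vanish; what is left is an \<open>\<real>\<close>-linear relation in \<open>B\<close>
  (\<open>dual_independentI\<close>). For spanning, every \<open>x\<close> agrees modulo \<open>Ker N\<close> with a real combination of
  \<open>S1\<close>, and \<open>Ker N\<close> is spanned over \<open>\<real>\<close> by \<open>N ` S1 \<union> S2\<close> (\<open>dual_spanningI\<close>).
\<close>

lemma dual_real_decomp: "c = of_real (dfst c) + of_real (dsnd c) * one_sharp"
  using Dual_eq[of "dfst c" "dsnd c"] by simp

lemma dual_real_eq_0_iff: "c = 0 \<longleftrightarrow> dfst c = 0 \<and> dsnd c = 0"
  by (cases c) (simp add: zero_dual_real_def)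

locale dual_module = module scale
  for scale :: "dual_real \<Rightarrow> 'v::ab_group_add \<Rightarrow> 'v"
begin

abbreviation scale_real :: "real \<Rightarrow> 'v \<Rightarrow> 'v"
  where "scale_real r \<equiv> scale (of_real r)"

abbreviation sharp :: "'v \<Rightarrow> 'v"
  where "sharp \<equiv> scale one_sharp"

sublocale real: vector_space scale_real
  by standard (simp_all add: scale_right_distrib scale_left_distrib)

sublocale sharp: module_hom scale_real scale_real sharp
  by unfold_locales (simp_all add: scale_right_distrib mult.commute)

lemma scale_eq_real_sharp: "scale c v = scale_real (dfst c) v + scale_real (dsnd c) (sharp v)"
  by (subst dual_real_decomp[of c]) (simp only: scale_left_distrib scale_scale)

lemma sharp_sharp [simp]: "sharp (sharp v) = 0"
  by (simp add: one_sharp_mult_self)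

lemma sharp_scale: "sharp (scale c v) = scale_real (dfst c) (sharp v)"
  by (subst scale_eq_real_sharp)
     (simp del: scale_scale add: sharp.add sharp.scale)

lemma subspace_imp_real_subspace: "subspace U \<Longrightarrow> real.subspace U"
  by (simp add: subspace_def real.subspace_def)

lemma real_span_subset_span: "real.span S \<subseteq> span S"
  by (rule real.span_minimal[OF span_superset]) (simp add: subspace_imp_real_subspace)

text \<open>
  In a relation, the real parts and the \<open>1\<^sup>#\<close>-parts of the \<open>S1\<close>-coefficients are separated by
  applying \<open>sharp\<close>: this kills the \<open>S2\<close>-terms and moves the real parts onto the vectors of
  \<open>sharp ` S1\<close>. Once they vanish, the \<open>1\<^sup>#\<close>-parts multiply these same vectors in the original
  relation, so that real independence can be used a second time, now together with \<open>S2\<close>.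
\<close>

lemma dual_independentI:
  assumes inj: "inj_on sharp S1" and disj: "sharp ` S1 \<inter> S2 = {}"
    and indep: "real.independent (sharp ` S1 \<union> S2)" and S2: "S2 \<subseteq> Ker_one_sharp scale"
  shows "dual_independent scale S1 S2"
  unfolding dual_independent_def
proof (intro allI impI, elim conjE)
  fix A B :: "'v set" and c :: "'v \<Rightarrow> dual_real" and d :: "'v \<Rightarrow> real"
  assume A: "finite A" "A \<subseteq> S1" and B: "finite B" "B \<subseteq> S2"
    and rel: "(\<Sum>v\<in>A. scale (c v) v) + (\<Sum>w\<in>B. scale_real (d w) w) = 0"
  have injA: "inj_on sharp A"
    using inj A(2) by (rule inj_on_subset)
  \<comment> \<open>Coefficients indexed by \<open>A\<close> are carried over to \<open>sharp ` A\<close> along this inverse.\<close>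
  define g where "g = inv_into A sharp"
  have g: "g (sharp v) = v" if "v \<in> A" for v
    using injA that by (simp add: g_def)
  have reindex: "(\<Sum>b\<in>sharp ` A. scale_real (f (g b)) b) = (\<Sum>v\<in>A. scale_real (f v) (sharp v))"
    for f :: "'v \<Rightarrow> real"
    by (subst sum.reindex[OF injA]) (auto intro!: sum.cong simp del: scale_scale simp: g)

  have sharp_B: "sharp w = 0" if "w \<in> B" for w
    using S2 B(2) that by (auto simp: Ker_one_sharp_def)
  have "sharp ((\<Sum>v\<in>A. scale (c v) v) + (\<Sum>w\<in>B. scale_real (d w) w)) = 0"
    by (simp only: rel scale_zero_right)
  then have "(\<Sum>v\<in>A. scale_real (dfst (c v)) (sharp v)) = 0"
    by (simp add: sharp.add sharp.sum sharp_scale sharp_B del: scale_scale)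
  then have "(\<Sum>b\<in>sharp ` A. scale_real (dfst (c (g b))) b) = 0"
    using reindex[of "\<lambda>v. dfst (c v)"] by simp
  then have "dfst (c (g b)) = 0" if "b \<in> sharp ` A" for b
    using real.independentD[OF indep, of "sharp ` A" "\<lambda>b. dfst (c (g b))"] A that by blast
  then have dfst: "dfst (c v) = 0" if "v \<in> A" for v
    using that g by force

  \<comment> \<open>Only the \<open>1\<^sup>#\<close>-parts are left, and they act through \<open>sharp\<close>.\<close>
  have "(\<Sum>v\<in>A. scale (c v) v) = (\<Sum>v\<in>A. scale_real (dsnd (c v)) (sharp v))"
    by (rule sum.cong[OF refl]) (subst scale_eq_real_sharp, simp add: dfst)
  also have "\<dots> = (\<Sum>b\<in>sharp ` A. scale_real (dsnd (c (g b))) b)"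
    using reindex[of "\<lambda>v. dsnd (c v)"] by simp
  finally have rel':
    "(\<Sum>b\<in>sharp ` A. scale_real (dsnd (c (g b))) b) + (\<Sum>w\<in>B. scale_real (d w) w) = 0"
    using rel by simp
  \<comment> \<open>Disjointness lets both families of coefficients be merged into one function.\<close>
  define u where "u b = (if b \<in> S2 then d b else dsnd (c (g b)))" for b
  have u_A: "u b = dsnd (c (g b))" if "b \<in> sharp ` A" for b
    using that A(2) disj by (auto simp: u_def)
  have u_B: "u w = d w" if "w \<in> B" for w
    using that B(2) by (auto simp: u_def)
  have "(\<Sum>b\<in>sharp ` A \<union> B. scale_real (u b) b)
      = (\<Sum>b\<in>sharp ` A. scale_real (u b) b) + (\<Sum>w\<in>B. scale_real (u w) w)"
    using A B disj by (intro sum.union_disjoint) auto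
  also have "\<dots> = 0"
    using rel' by (simp add: u_A u_B cong: sum.cong)
  finally have u0: "u b = 0" if "b \<in> sharp ` A \<union> B" for b
    using real.independentD[OF indep, of "sharp ` A \<union> B" u] A B that by blast
  have "d w = 0" if "w \<in> B" for w
    using u0[of w] u_B that by simp
  moreover have "c v = 0" if "v \<in> A" for v
    using u0[of "sharp v"] u_A[of "sharp v"] g dfst that by (simp add: dual_real_eq_0_iff)
  ultimately show "(\<forall>v\<in>A. c v = 0) \<and> (\<forall>w\<in>B. d w = 0)"
    by blast
qed

text \<open>
  The first hypothesis makes the real span of \<open>S1\<close> surject onto \<open>V\<close> modulo the kernel of \<open>sharp\<close>;
  the second one covers that kernel.
\<close>

lemma dual_spanningI:
  assumes range: "range sharp \<subseteq> real.span (sharp ` S1)"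
    and ker: "Ker_one_sharp scale \<subseteq> real.span (sharp ` S1 \<union> S2)"
  shows "dual_spanning scale S1 S2"
  unfolding dual_spanning_def
proof
  fix x
  \<comment> \<open>Correct \<open>x\<close> by a real combination of \<open>S1\<close> with the same image, landing in the kernel.\<close>
  obtain h where h: "h \<in> real.span S1" "sharp x = sharp h"
    using range by (auto simp: sharp.span_image)
  have "x - h \<in> Ker_one_sharp scale"
    using h(2) by (simp add: Ker_one_sharp_def sharp.diff)
  then obtain y z where yz: "x - h = y + z" "y \<in> real.span (sharp ` S1)" "z \<in> real.span S2"
    using ker unfolding real.span_Un by blast
  \<comment> \<open>Over the dual numbers, \<open>sharp ` S1\<close> is already generated by \<open>S1\<close>.\<close>
  have "real.span (sharp ` S1) \<subseteq> span S1"
    by (rule real.span_minimal) (auto simp: subspace_imp_real_subspace intro: span_base span_scale)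
  then have "h + y \<in> span S1"
    using h(1) yz(2) real_span_subset_span by (blast intro: span_add)
  then obtain A c where A: "finite A" "A \<subseteq> S1" "h + y = (\<Sum>v\<in>A. scale (c v) v)"
    unfolding span_explicit by blast
  obtain B d where B: "finite B" "B \<subseteq> S2" "z = (\<Sum>w\<in>B. scale_real (d w) w)"
    using yz(3) unfolding real.span_explicit by blast
  have "x = (\<Sum>v\<in>A. scale (c v) v) + (\<Sum>w\<in>B. scale_real (d w) w)"
    unfolding A(3)[symmetric] B(3)[symmetric] using yz(1) by (simp add: algebra_simps)
  with A B show "\<exists>A B c d. finite A \<and> A \<subseteq> S1 \<and> finite B \<and> B \<subseteq> S2 \<and>
      x = (\<Sum>v\<in>A. scale (c v) v) + (\<Sum>w\<in>B. scale_real (d w) w)"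
    by blast
qed

lemma exists_dual_basis: "\<exists>S1 S2. dual_basis scale S1 S2"
proof -
  obtain B0 where B0: "B0 \<subseteq> range sharp" "real.independent B0" "range sharp \<subseteq> real.span B0"
    using real.maximal_independent_subset by blast
  have "B0 \<subseteq> Ker_one_sharp scale"
    using B0(1) by (auto simp: Ker_one_sharp_def one_sharp_mult_self)
  then obtain B where B: "B0 \<subseteq> B" "B \<subseteq> Ker_one_sharp scale" "real.independent B"
      "Ker_one_sharp scale \<subseteq> real.span B"
    using real.maximal_independent_subset_extend B0(2) by metis
  define S1 where "S1 = inv sharp ` B0"
  have sharp_inv: "sharp (inv sharp b) = b" if "b \<in> B0" for b
    using B0(1) that by (auto intro: f_inv_into_f)
  have image: "sharp ` S1 = B0"
    using sharp_inv by (force simp: S1_def image_image)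
  have "inj_on sharp S1"
    by (auto simp: S1_def inj_on_def sharp_inv)
  moreover have union: "sharp ` S1 \<union> (B - B0) = B"
    using image B(1) by blast
  ultimately have "dual_independent scale S1 (B - B0)"
    using B image by (intro dual_independentI) auto
  moreover have "dual_spanning scale S1 (B - B0)"
    using B0(3) B(4) by (intro dual_spanningI) (simp_all only: union, simp add: image)
  ultimately have "dual_basis scale S1 (B - B0)"
    using B(2) by (auto simp: dual_basis_def)
  then show ?thesis by blast
qed

end

theorem proposition1p1:
  fixes scale :: "dual_real \<Rightarrow> 'v::ab_group_add \<Rightarrow> 'v"
  assumes "module scale"
  shows "\<exists>S1 S2. dual_basis scale S1 S2"
proof -
  interpret dual_module scale
    using assms by (rule dual_module.intro)
  show ?thesis
    by (rule exists_dual_basis)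
qed

end
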